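(* Let $a,b,c\in i\mathbb{R}$. The following conditions are equivalent: (1) $a+b=c$; (2) there exist functions $\theta_1,\theta_2:\mathbb{R}\to\mathbb{R}$ such that for every $x\in\mathbb{R}$ one has the polynomial identity in $\mathbb{C}[T]$ $$1-(e^{ax}+e^{bx})T+e^{cx}T^2=(1-e^{i\theta_1(x)}T)(1-e^{i\theta_2(x)}T).$$
   Context: Condition (2) is what the paper calls unitariness of the polynomial $H^{abc}(T)=1-(\chi_a+\chi_b)T+\chi_cT^2$ with coefficients in the virtual character ring of $\mathbb{R}$, where $\chi_a(x)=e^{ax}$; its specialization at $x\in\mathbb{R}$ is $H^{abc}_x(T)=1-(e^{ax}+e^{bx})T+e^{cx}T^2$. *)

theory Defs
  imports Complex_Main "HOL-Computational_Algebra.Polynomial"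
begin

end

theory Submission imports Defs begin

text \<open>
  Complex numbers \<open>u\<close>, \<open>v\<close> of modulus one satisfy \<open>u + v = u v (cnj u + cnj v)\<close>, so a nonzero sum of
  two such numbers determines their product. Hence (2) forces \<open>e\<^bsup>(a + b - c) x\<^esup> = 1\<close> as soon as
  \<open>e\<^bsup>a x\<^esup> + e\<^bsup>b x\<^esup> \<noteq> 0\<close>, and a single small nonzero \<open>x\<close> suffices to conclude.
\<close>

lemma unit_sum_determines_mult:
  fixes u v p q :: complex
  assumes "norm u = 1" "norm v = 1" "norm p = 1" "norm q = 1"
    and eq: "u + v = p + q" and nz: "u + v \<noteq> 0"
  shows "u * v = p * q"
proof -
  have *: "y + z = (y * z) * cnj (y + z)" if "norm y = 1" "norm z = 1" for y z :: complex
  proof -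
    have "y * cnj y = 1" "z * cnj z = 1"
      using that by (simp_all add: complex_norm_square [symmetric])
    then show ?thesis by (simp add: algebra_simps)
  qed
  \<comment> \<open>Since u + v = p + q, the identity \<open>*\<close> makes both sides equal to
    this common sum; the factor \<open>cnj (u + v)\<close> is nonzero and cancels.\<close>
  have "(u * v) * cnj (u + v) = (p * q) * cnj (u + v)"
    using * [of u v] * [of p q] assms by metis
  then show ?thesis using nz by (metis complex_cnj_zero_iff mult_right_cancel)
qed

lemma exp_imaginary_mult_of_real:
  "exp (\<i> * of_real s * of_real x) = cis (s * x)"
  by (simp add: cis_conv_exp mult.assoc)

theorem theorem2:
  fixes a b c :: complex
  assumes "a \<in> (*) \<i> ` \<real>" and "b \<in> (*) \<i> ` \<real>" and "c \<in> (*) \<i> ` \<real>"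
  shows "a + b = c \<longleftrightarrow>
    (\<exists>\<theta>\<^sub>1 \<theta>\<^sub>2 :: real \<Rightarrow> real. \<forall>x::real.
      [:1, - (exp (a * of_real x) + exp (b * of_real x)), exp (c * of_real x):] =
      [:1, - exp (\<i> * of_real (\<theta>\<^sub>1 x)):] * [:1, - exp (\<i> * of_real (\<theta>\<^sub>2 x)):])"
proof -
  obtain r s t :: real
    where abc: "a = \<i> * of_real r" "b = \<i> * of_real s" "c = \<i> * of_real t"
    using assms by (auto elim!: Reals_cases)
  \<comment> \<open>Comparing coefficients of T and T^2 reduces the polynomial identity to a sum and
    a product of points on the unit circle; both directions work with these two equations
    only.\<close>
  have factor_iff:
    "[:1, - (exp (a * of_real x) + exp (b * of_real x)), exp (c * of_real x):] =
      [:1, - exp (\<i> * of_real y):] * [:1, - exp (\<i> * of_real z):] \<longleftrightarrow>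
      cis (r * x) + cis (s * x) = cis y + cis z \<and> cis (t * x) = cis y * cis z" for x y z :: real
  proof -
    have "[:1, - cis y:] * [:1, - cis z:] = [:1, - (cis y + cis z), cis y * cis z:]"
      by simp
    then show ?thesis
      unfolding abc exp_imaginary_mult_of_real cis_conv_exp [symmetric]
      by (simp only: pCons_eq_iff neg_equal_iff_equal simp_thms)
  qed
  show ?thesis
  proof
    assume "a + b = c"
    then have "of_real (r + s) = (of_real t :: complex)"
      unfolding abc by (simp flip: distrib_left)
    then have "r + s = t" by (simp only: of_real_eq_iff)
    then have "cis (t * x) = cis (r * x) * cis (s * x)" for x
      by (auto simp: cis_mult distrib_right)
    \<comment> \<open>The witnesses are the linear phases \<open>r * x\<close> and
      \<open>s * x\<close>, for which the sum condition is trivial.\<close>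
    then show "\<exists>\<theta>\<^sub>1 \<theta>\<^sub>2 :: real \<Rightarrow> real. \<forall>x::real.
      [:1, - (exp (a * of_real x) + exp (b * of_real x)), exp (c * of_real x):] =
      [:1, - exp (\<i> * of_real (\<theta>\<^sub>1 x)):] * [:1, - exp (\<i> * of_real (\<theta>\<^sub>2 x)):]"
      unfolding factor_iff by blast
  next
    assume "\<exists>\<theta>\<^sub>1 \<theta>\<^sub>2 :: real \<Rightarrow> real. \<forall>x::real.
      [:1, - (exp (a * of_real x) + exp (b * of_real x)), exp (c * of_real x):] =
      [:1, - exp (\<i> * of_real (\<theta>\<^sub>1 x)):] * [:1, - exp (\<i> * of_real (\<theta>\<^sub>2 x)):]"
    then obtain \<theta>\<^sub>1 \<theta>\<^sub>2 :: "real \<Rightarrow> real"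
      where factors: "cis (r * x) + cis (s * x) = cis (\<theta>\<^sub>1 x) + cis (\<theta>\<^sub>2 x)"
        "cis (t * x) = cis (\<theta>\<^sub>1 x) * cis (\<theta>\<^sub>2 x)" for x
      unfolding factor_iff by blast
    \<comment> \<open>This bound strictly exceeds the absolute values of \<open>r\<close>,
      \<open>s\<close> and \<open>r + s - t\<close>, so at x = 1/d all three phases have absolute
      value below 1; the summand 1 gives strictness and d > 0.\<close>
    define d where "d = 1 + \<bar>r\<bar> + \<bar>s\<bar> + \<bar>t\<bar>"
    define x where "x = 1 / d"
    have "d > 0" by (simp add: d_def add_pos_nonneg)
    then have "x > 0" by (simp add: x_def)
    have small: "\<bar>k * x\<bar> < 1" if "\<bar>k\<bar> < d" for k
      using that \<open>d > 0\<close> by (simp add: x_def abs_mult)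
    have pi: "1 \<le> pi / 2" using pi_ge_two by simp
    have "cos (k * x) > 0" if "\<bar>k\<bar> < d" for k
      using small [OF that] pi by (intro cos_gt_zero_pi) linarith+
    then have "cos (r * x) > 0" "cos (s * x) > 0" by (simp_all add: d_def)
    \<comment> \<open>Both phases lie within (-\<pi>/2, \<pi>/2), so the two points are in the open
      right half-plane and cannot cancel.\<close>
    then have "Re (cis (r * x) + cis (s * x)) > 0" by simp
    then have "cis (r * x) + cis (s * x) \<noteq> 0" by force
    then have "cis (r * x) * cis (s * x) = cis (t * x)"
      unfolding factors(2) using factors(1) by (intro unit_sum_determines_mult) simp_all
    then have "cis ((r + s - t) * x) = 1"
      unfolding left_diff_distrib distrib_right cis_mult cis_divide [symmetric] by simp
    then have "sin ((r + s - t) * x) = 0"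
      by (metis cis.simps(2) one_complex.simps(2))
    moreover have "\<bar>(r + s - t) * x\<bar> < 1" by (rule small) (simp add: d_def)
    \<comment> \<open>The only zero of sin in (-\<pi>, \<pi>) is 0, so the smallness of the phase
      rules out nonzero multiples of \<pi>.\<close>
    ultimately have "(r + s - t) * x = 0"
      using pi by - (rule sin_eq_0_pi, linarith+)
    then have "r + s = t" using \<open>x > 0\<close> by simp
    then show "a + b = c" unfolding abc by (auto simp: distrib_left)
  qed
qed

end
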